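(* Let $L$ be a finite lattice, $\tilde L$ as in the context, and $$\mathcal{S}=\{\overline{T}|_L\mid T \text{ is a t-norm on } C(\tilde L) \text{ satisfying condition (C)}\}.$$ Then $\mathcal{S}$ is contained in the set of t-norms on $L$, and $(\mathcal{S},\le)$, ordered pointwise ($T_1\le T_2$ iff $T_1(x,y)\le T_2(x,y)$ for all $x,y\in L$), is a lattice.
   Context: For a lattice $L$ with bottom $0$ and top $1$: an atom is an element covering $0$; $A(L)$ is the set of atoms; $J(L)$ the set of non-zero join-irreducible elements; $H(L)=J(L)\setminus A(L)$. $\tilde L$ is obtained from the finite lattice $L$ by adding, for each $p\in H(L)$, a new distinct element $w_p$ with $0\prec w_p\prec p$ (so $w_p\le x$ for $x\in L$ iff $p\le x$); $\tilde L$ is a finite atomistic lattice containing $L$ as a sublattice with the same $0$ and $1$, with $A(\tilde L)=A(L)\cup\{w_p\mid p\in H(L)\}$. $A_{\tilde L}(x)=\{a\in A(\tilde L)\mid a\le x\}$; $C(\tilde L)=A(\tilde L)\cup\{0,1\}$ with the inherited order. A t-norm on a bounded poset with top $1$ is a binary operation that is monotone in each argument, commutative, associative, with neutral element $1$. For a t-norm $T$ on $C(\tilde L)$, $\overline{T}(x,y)=\bigvee_{u\in\kappa(x)}\bigvee_{v\in\kappa(y)}T(u,v)$ for $x,y\in\tilde L$, where $\kappa(x)=\{u\in C(\tilde L)\setminus\{0\}\mid u\le x\}$, and $\overline T|_L$ is its restriction to $L\times L$. Condition (C) for $T$: for every $p\in H(L)\setminus\{1\}$, if $T(w_p,w_p)\ne0$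 then there exists $u\in A_{\tilde L}(p)\setminus\{w_p\}$ with $T(u,u)\ne0$. *)

theory Defs
  imports "HOL-Algebra.Lattice" "HOL-Library.Finite_Lattice"
begin

text \<open>
  A finite lattice \<open>L\<close> is a type of sort \<open>{finite, bounded_lattice}\<close>; its bottom and top
  are the class constants \<open>bot\<close> and \<open>top\<close>. The trivial lattice (\<open>bot = top\<close>) is included.
\<close>

hide_const (open) Order.top Order.bottom

definition atoms :: "'a::order_bot set" where
  "atoms = {a. bot < a \<and> \<not> (\<exists>z. bot < z \<and> z < a)}"

definition join_irreducibles :: "'a::bounded_lattice set" where
  "join_irreducibles = {p. p \<noteq> bot \<and> (\<forall>x y. sup x y = p \<longrightarrow> x = p \<or> y = p)}"

definition H_set :: "'a::bounded_lattice set" where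
  "H_set = join_irreducibles - atoms"

text \<open>
  The lattice \<open>L~\<close>: \<open>Inl x\<close> is the element \<open>x\<close> of \<open>L\<close>, and \<open>Inr p\<close> is the added element \<open>w_p\<close>.
\<close>

typedef (overloaded) ('a::bounded_lattice) tilde = "range Inl \<union> Inr ` H_set :: ('a + 'a) set"
  by auto

setup_lifting type_definition_tilde

lift_definition emb :: "'a::bounded_lattice \<Rightarrow> 'a tilde" is Inl
  by simp

text \<open>\<open>w_atom p\<close> is meaningful only for \<open>p \<in> H_set\<close>; elsewhere it takes the dummy value \<open>emb p\<close>.\<close>

lift_definition w_atom :: "'a::bounded_lattice \<Rightarrow> 'a tilde" is
  "\<lambda>p. if p \<in> H_set then Inr p else Inl p"
  by simp

lemma emb_eq_iff [simp]: "emb x = emb y \<longleftrightarrow> x = y"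
  by transfer simp

lemma w_eq_iff [simp]: "p \<in> H_set \<Longrightarrow> q \<in> H_set \<Longrightarrow> w_atom p = w_atom q \<longleftrightarrow> p = q"
  by transfer simp

lemma emb_neq_w_atom [simp]: "p \<in> H_set \<Longrightarrow> emb x \<noteq> w_atom p" "p \<in> H_set \<Longrightarrow> w_atom p \<noteq> emb x"
  by (transfer; simp)+

lemma tilde_cases [case_names emb w_atom]:
  obtains x where "z = emb x" | p where "p \<in> H_set" "z = w_atom p"
proof -
  have "(\<exists>x. z = emb x) \<or> (\<exists>p\<in>H_set. z = w_atom p)"
    by transfer auto
  then show thesis
    using that by blast
qed

lemma UNIV_tilde: "(UNIV :: 'a::bounded_lattice tilde set) = range emb \<union> w_atom ` H_set"
  by (blast intro: tilde_cases)

lemma bot_notin_H_set [simp]: "(bot :: 'a::bounded_lattice) \<notin> H_set"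
  by (simp add: H_set_def join_irreducibles_def)

text \<open>The clauses encode that \<open>w_p\<close> covers \<open>bot\<close> and lies below exactly those \<open>x\<close> in \<open>L\<close> with
  \<open>p \<le> x\<close>; distinct added elements are incomparable.\<close>

fun sum_le :: "'a::bounded_lattice + 'a \<Rightarrow> 'a + 'a \<Rightarrow> bool" where
  "sum_le (Inl x) (Inl y) \<longleftrightarrow> x \<le> y"
| "sum_le (Inr p) (Inl x) \<longleftrightarrow> p \<le> x"
| "sum_le (Inl x) (Inr p) \<longleftrightarrow> x = bot"
| "sum_le (Inr p) (Inr q) \<longleftrightarrow> p = q"

fun sum_sup :: "'a::bounded_lattice + 'a \<Rightarrow> 'a + 'a \<Rightarrow> 'a + 'a" where
  "sum_sup (Inl x) (Inl y) = Inl (sup x y)"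
| "sum_sup (Inr p) (Inl x) = (if x = bot then Inr p else Inl (sup p x))"
| "sum_sup (Inl x) (Inr p) = (if x = bot then Inr p else Inl (sup x p))"
| "sum_sup (Inr p) (Inr q) = (if p = q then Inr p else Inl (sup p q))"

fun sum_inf :: "'a::bounded_lattice + 'a \<Rightarrow> 'a + 'a \<Rightarrow> 'a + 'a" where
  "sum_inf (Inl x) (Inl y) = Inl (inf x y)"
| "sum_inf (Inr p) (Inl x) = (if p \<le> x then Inr p else Inl bot)"
| "sum_inf (Inl x) (Inr p) = (if p \<le> x then Inr p else Inl bot)"
| "sum_inf (Inr p) (Inr q) = (if p = q then Inr p else Inl bot)"

instantiation tilde :: (bounded_lattice) bounded_lattice
begin

lift_definition less_eq_tilde :: "'a tilde \<Rightarrow> 'a tilde \<Rightarrow> bool" is sum_le .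

definition less_tilde :: "'a tilde \<Rightarrow> 'a tilde \<Rightarrow> bool" where
  "less_tilde x y \<longleftrightarrow> x \<le> y \<and> \<not> y \<le> x"

lift_definition sup_tilde :: "'a tilde \<Rightarrow> 'a tilde \<Rightarrow> 'a tilde" is sum_sup
  by (auto split: if_splits)

lift_definition inf_tilde :: "'a tilde \<Rightarrow> 'a tilde \<Rightarrow> 'a tilde" is sum_inf
  by (auto split: if_splits)

lift_definition bot_tilde :: "'a tilde" is "Inl bot"
  by simp

lift_definition top_tilde :: "'a tilde" is "Inl top"
  by simp

instance
proof
  fix x y z :: "'a tilde"
  show "x < y \<longleftrightarrow> x \<le> y \<and> \<not> y \<le> x"
    by (rule less_tilde_def)
  show "x \<le> x"
    by transfer auto
  show "x \<le> y \<Longrightarrow> y \<le> z \<Longrightarrow> x \<le> z"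
    by transfer (auto dest: order.trans simp: bot_unique)
  show "x \<le> y \<Longrightarrow> y \<le> x \<Longrightarrow> x = y"
    by transfer (auto simp: bot_unique)
  show "inf x y \<le> x" "inf x y \<le> y"
    by (transfer; auto)+
  show "x \<le> y \<Longrightarrow> x \<le> z \<Longrightarrow> x \<le> inf y z"
    by transfer (auto simp: bot_unique)
  show "x \<le> sup x y" "y \<le> sup x y"
    by (transfer; auto)+
  show "y \<le> x \<Longrightarrow> z \<le> x \<Longrightarrow> sup y z \<le> x"
    by transfer (auto simp: bot_unique)
  show "bot \<le> x"
    by transfer auto
  show "x \<le> top"
    by transfer auto
qed

end

instantiation tilde :: ("{finite, bounded_lattice}") finite_lattice_complete
begin

definition Inf_tilde :: "'a tilde set \<Rightarrow> 'a tilde" where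
  "Inf_tilde A = Finite_Set.fold inf top A"

definition Sup_tilde :: "'a tilde set \<Rightarrow> 'a tilde" where
  "Sup_tilde A = Finite_Set.fold sup bot A"

instance
proof
  show fin: "finite (UNIV :: 'a tilde set)"
    unfolding UNIV_tilde by simp
  show "(bot :: 'a tilde) = Inf_fin UNIV"
    by (rule order.antisym) (auto intro: Inf_fin.coboundedI fin)
  show "(top :: 'a tilde) = Sup_fin UNIV"
    by (rule order.antisym) (auto intro: Sup_fin.coboundedI fin)
qed (fact Inf_tilde_def Sup_tilde_def)+

end

lemma emb_le_emb [simp]: "emb x \<le> emb y \<longleftrightarrow> x \<le> y"
  by transfer simp

lemma w_le_emb [simp]: "p \<in> H_set \<Longrightarrow> w_atom p \<le> emb x \<longleftrightarrow> p \<le> x"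
  by transfer simp

lemma emb_le_w [simp]: "p \<in> H_set \<Longrightarrow> emb x \<le> w_atom p \<longleftrightarrow> x = bot"
  by transfer simp

lemma w_le_w [simp]: "p \<in> H_set \<Longrightarrow> q \<in> H_set \<Longrightarrow> w_atom p \<le> w_atom q \<longleftrightarrow> p = q"
  by transfer simp

lemma emb_bot: "emb bot = bot" and emb_top: "emb top = top"
  by (transfer; simp)+

lemma emb_sup: "emb (sup x y) = sup (emb x) (emb y)"
  and emb_inf: "emb (inf x y) = inf (emb x) (emb y)"
  by (transfer; simp)+

lemma atoms_tilde:
  "(atoms :: 'a::{finite, bounded_lattice} tilde set) = emb ` atoms \<union> w_atom ` H_set"
proof (rule Set.set_eqI)
  fix z :: "'a tilde"
  show "z \<in> atoms \<longleftrightarrow> z \<in> emb ` atoms \<union> w_atom ` H_set"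
  proof (cases z rule: tilde_cases)
    case (w_atom p)
    have "u = bot \<or> u = w_atom p" if "u \<le> w_atom p" for u
      using that w_atom by (cases u rule: tilde_cases) (auto simp: emb_bot)
    moreover have "w_atom p \<noteq> bot"
      using w_atom by (metis emb_bot emb_neq_w_atom(2))
    ultimately show ?thesis
      using w_atom by (auto simp: atoms_def less_le)
  next
    case (emb x)
    have "emb x \<in> atoms \<longleftrightarrow> x \<in> atoms"
    proof
      assume at: "emb x \<in> atoms"
      show "x \<in> atoms"
        unfolding atoms_def mem_Collect_eq
      proof (intro conjI notI)
        show "bot < x"
          using at emb_bot[where 'a = 'a] by (auto simp: atoms_def bot.not_eq_extremum[symmetric])
        assume "\<exists>y. bot < y \<and> y < x"
        then obtain y where y: "bot < y" "y < x"
          by blast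
        then have "bot < emb y" "emb y < emb x"
          by (auto simp: less_le emb_bot[symmetric])
        then show False
          using at by (auto simp: atoms_def)
      qed
    next
      assume at: "x \<in> atoms"
      then have neq: "x \<noteq> bot"
        by (auto simp: atoms_def)
      have "u = bot \<or> u = emb x" if le: "u \<le> emb x" for u
      proof (cases u rule: tilde_cases)
        case (emb y)
        then show ?thesis
          using le at by (auto simp: atoms_def less_le emb_bot[symmetric])
      next
        case (w_atom p)
        then have "p \<le> x" "p \<noteq> bot" "p \<notin> atoms"
          using le by (auto simp: H_set_def join_irreducibles_def)
        then show ?thesis
          using at by (auto simp: atoms_def less_le)
      qed
      moreover have "emb x \<noteq> bot"
        using neq by (simp add: emb_bot[symmetric])
      ultimately show "emb x \<in> atoms"
        by (auto simp: atoms_def less_le)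
    qed
    then show ?thesis
      using emb by auto
  qed
qed

definition C_tilde :: "'a::bounded_lattice tilde set" where
  "C_tilde = atoms \<union> {bot, top}"

text \<open>T-norms on a subset \<open>P\<close> of an ordered type, where \<open>P\<close> carries the inherited order and contains
  \<open>top\<close>. Values of \<open>T\<close> outside \<open>P \<times> P\<close> are irrelevant.\<close>

definition tnorm_on :: "'b::order_top set \<Rightarrow> ('b \<Rightarrow> 'b \<Rightarrow> 'b) \<Rightarrow> bool" where
  "tnorm_on P T \<longleftrightarrow>
    (\<forall>x\<in>P. \<forall>y\<in>P. T x y \<in> P) \<and>
    (\<forall>x\<in>P. \<forall>y\<in>P. \<forall>z\<in>P. y \<le> z \<longrightarrow> T x y \<le> T x z \<and> T y x \<le> T z x) \<and>
    (\<forall>x\<in>P. \<forall>y\<in>P. T x y = T y x) \<and>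
    (\<forall>x\<in>P. \<forall>y\<in>P. \<forall>z\<in>P. T (T x y) z = T x (T y z)) \<and>
    (\<forall>x\<in>P. T x top = x \<and> T top x = x)"

definition kappa :: "'a::bounded_lattice tilde \<Rightarrow> 'a tilde set" where
  "kappa x = {u \<in> C_tilde - {bot}. u \<le> x}"

definition tbar :: "('a::{finite, bounded_lattice} tilde \<Rightarrow> 'a tilde \<Rightarrow> 'a tilde)
    \<Rightarrow> 'a tilde \<Rightarrow> 'a tilde \<Rightarrow> 'a tilde" where
  "tbar T x y = (SUP u\<in>kappa x. SUP v\<in>kappa y. T u v)"

definition cond_C :: "('a::bounded_lattice tilde \<Rightarrow> 'a tilde \<Rightarrow> 'a tilde) \<Rightarrow> bool" where
  "cond_C T \<longleftrightarrow> (\<forall>p\<in>H_set - {top}. T (w_atom p) (w_atom p) \<noteq> bot \<longrightarrow>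
    (\<exists>u\<in>{a \<in> atoms. a \<le> emb p} - {w_atom p}. T u u \<noteq> bot))"

text \<open>
  The restriction of \<open>tbar T\<close> to \<open>L \<times> L\<close> keeps its values in \<open>L~\<close>: that they lie in \<open>L\<close> is not
  presupposed. Accordingly, t-norms on \<open>L\<close> are regarded as \<open>L~\<close>-valued functions.
\<close>

definition restrict_L :: "('a::bounded_lattice tilde \<Rightarrow> 'a tilde \<Rightarrow> 'a tilde)
    \<Rightarrow> 'a \<Rightarrow> 'a \<Rightarrow> 'a tilde" where
  "restrict_L F = (\<lambda>x y. F (emb x) (emb y))"

definition S_set :: "('a::{finite, bounded_lattice} \<Rightarrow> 'a \<Rightarrow> 'a tilde) set" where
  "S_set = {restrict_L (tbar T) | T. tnorm_on C_tilde T \<and> cond_C T}"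

definition tnorms_L :: "('a::bounded_lattice \<Rightarrow> 'a \<Rightarrow> 'a tilde) set" where
  "tnorms_L = {\<lambda>x y. emb (t x y) | t. tnorm_on UNIV t}"

definition pointwise_order :: "('a \<Rightarrow> 'a \<Rightarrow> 'b::order) set \<Rightarrow> ('a \<Rightarrow> 'a \<Rightarrow> 'b) gorder" where
  "pointwise_order F =
    \<lparr>carrier = F, eq = (=), le = (\<lambda>T1 T2. \<forall>x y. T1 x y \<le> T2 x y)\<rparr>"

end

theory Submission
  imports Defs
begin

text \<open>
  Distinct atoms are incomparable, so a t-norm \<open>T\<close> on \<open>C_tilde\<close> is determined by the set \<open>E\<close> of its
  elements with nonzero square, and \<open>tbar T x y\<close> for \<open>x, y \<noteq> top\<close> is the join of the atoms of \<open>E\<close>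
  below \<open>inf x y\<close>. Condition (C) says exactly that such a join is never a single \<open>w_p\<close>, so that it
  lies in \<open>L\<close>. Taking unions of the sets \<open>E\<close> preserves condition (C) and corresponds to pointwise
  joins, and \<open>E = {}\<close> gives a least element. A finite join-semilattice with a least element is a lattice.
\<close>

section \<open>Finite join-semilattices of functions\<close>

lemma lattice_pointwise_order:
  fixes F :: "('a \<Rightarrow> 'a \<Rightarrow> 'c::lattice) set"
  assumes fin: "finite F"
    and sup_closed: "\<And>f g. f \<in> F \<Longrightarrow> g \<in> F \<Longrightarrow> sup f g \<in> F"
    and least: "b \<in> F" "\<And>f. f \<in> F \<Longrightarrow> b \<le> f"
  shows "lattice (pointwise_order F)"
proof -
  let ?P = "pointwise_order F"
  have carr: "carrier ?P = F" and le: "\<And>f g. f \<sqsubseteq>\<^bsub>?P\<^esub> g \<longleftrightarrow> f \<le> g"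
    by (simp_all add: pointwise_order_def le_fun_def)
  have eq_P: "(.=\<^bsub>?P\<^esub>) = (=)"
    by (simp add: pointwise_order_def)
  interpret partial_order ?P
    by unfold_locales (auto simp: carr eq_P le)
  show ?thesis
  proof unfold_locales
    fix f g assume fg: "f \<in> carrier ?P" "g \<in> carrier ?P"
    then have "least ?P (sup f g) (Upper ?P {f, g})"
      using sup_closed by (auto simp: least_def Upper_def carr le)
    then show "\<exists>s. least ?P s (Upper ?P {f, g})"
      by blast
    \<comment> \<open>The meet of \<open>f\<close> and \<open>g\<close> is a maximal element
      \<open>m\<close> of \<open>B\<close>: for \<open>h\<close> in \<open>B\<close> the join
      \<open>sup m h\<close> is again in \<open>B\<close>, so maximality makes \<open>m\<close>
      absorb \<open>h\<close>. The least element \<open>b\<close> keeps \<open>B\<close>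
      nonempty.\<close>
    define B where "B = {h \<in> F. h \<le> f \<and> h \<le> g}"
    have B: "finite B" "B \<noteq> {}"
      using fin least fg by (auto simp: B_def carr)
    then obtain m where m: "m \<in> B" "\<And>h. h \<in> B \<Longrightarrow> m \<le> h \<Longrightarrow> m = h"
      by (meson finite_has_maximal)
    have "h \<le> m" if "h \<in> B" for h
    proof -
      have "sup m h \<in> B"
        using m(1) that sup_closed by (auto simp: B_def)
      then have "m = sup m h"
        using m(2) by simp
      then show ?thesis
        by (metis sup.cobounded2)
    qed
    then have "greatest ?P m (Lower ?P {f, g})"
      using fg m(1) by (auto simp: greatest_def Lower_def carr le B_def)
    then show "\<exists>s. greatest ?P s (Lower ?P {f, g})"
      by blast
  qed
qed

section \<open>T-norms obtained from interior operators\<close>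

lemma tnorm_on_le:
  assumes "tnorm_on P T" "top \<in> P" "x \<in> P" "y \<in> P"
  shows "T x y \<le> x" "T x y \<le> y"
  using assms unfolding tnorm_on_def by (metis top_greatest)+

text \<open>Below top, \<open>g\<close> is an interior operator; \<open>idem\<close> is its
  idempotence relative to a further meet, which is what associativity asks for. Everything is
  required only away from top because \<open>g top\<close> carries no information in the
  application.\<close>

lemma tnorm_on_interior:
  fixes g :: "'a::bounded_lattice \<Rightarrow> 'a"
  assumes le: "\<And>z. z \<noteq> top \<Longrightarrow> g z \<le> z"
    and mono: "\<And>y z. z \<noteq> top \<Longrightarrow> y \<le> z \<Longrightarrow> g y \<le> g z"
    and idem: "\<And>z w. z \<noteq> top \<Longrightarrow> g (inf (g z) w) = g (inf z w)"
  shows "tnorm_on UNIV (\<lambda>x y. if x = top then y else if y = top then x else g (inf x y))"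
    (is "tnorm_on UNIV ?t")
proof -
  have inf_top: "inf x y = top \<longleftrightarrow> x = top \<and> y = top" for x y :: 'a
    by (metis inf.absorb_iff2 inf.cobounded1 inf.cobounded2 top_unique inf_top_left)
  have comm: "?t x y = ?t y x" for x y
    by (simp add: inf.commute)
  have le1: "g (inf x y) \<le> x" if "x \<noteq> top" for x y
    using le[of "inf x y"] that inf_top by (auto intro: order.trans)
  have mon: "?t x y \<le> ?t x z" if "y \<le> z" for x y z
  proof (cases "x = top \<or> z = top")
    case True
    then show ?thesis using that le1 by auto
  next
    case False
    moreover have "y \<noteq> top" using that False top_unique by auto
    ultimately show ?thesis
      using that by (auto intro!: mono simp: inf_top le_infI2)
  qed
  have mon': "?t y x \<le> ?t z x" if "y \<le> z" for x y z
    using mon[OF that, of x] by (simp only: comm[of _ x])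
  \<comment> \<open>An inner value of \<open>?t\<close> must not be mistaken for the unit by the
    outer test.\<close>
  have gtop: "g (inf x y) \<noteq> top" if "x \<noteq> top" for x y
    using le1[OF that, of y] that by (metis top_unique)
  have assoc: "?t (?t x y) z = ?t x (?t y z)" for x y z
  proof (cases "x = top \<or> y = top \<or> z = top")
    case False
    \<comment> \<open>Both sides collapse to \<open>g\<close> of the meet of all three
      arguments.\<close>
    have "g (inf (g (inf x y)) z) = g (inf (g (inf y z)) x)"
      using False idem[of "inf x y" z] idem[of "inf y z" x] by (simp add: inf_top ac_simps)
    then show ?thesis using False gtop by (simp add: inf_commute)
  qed auto
  show ?thesis
    unfolding tnorm_on_def
    by (intro conjI ballI impI; (rule mon mon' comm assoc UNIV_I)?) simp_all
qed

section \<open>Classification of the t-norms on \<open>C_tilde\<close>\<close>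

definition idem_tnorm :: "'b::bounded_lattice set \<Rightarrow> 'b \<Rightarrow> 'b \<Rightarrow> 'b" where
  "idem_tnorm E u v =
    (if u = top then v else if v = top then u else if u = v \<and> u \<in> E then u else bot)"

lemma C_tilde_cases:
  assumes "u \<in> C_tilde" "v \<in> C_tilde" "u \<le> v"
  shows "u = bot \<or> v = top \<or> u = v"
  using assms top_unique by (auto simp: C_tilde_def atoms_def less_le bot_unique)

lemma bot_in_C_tilde [simp]: "bot \<in> C_tilde" and top_in_C_tilde [simp]: "top \<in> C_tilde"
  by (simp_all add: C_tilde_def)

text \<open>Monotonicity has few cases, since comparable elements of \<open>C_tilde\<close> are
  equal unless the smaller is bot or the larger is top. As \<open>idem_tnorm\<close> tests for top
  first, the unit law also holds when top is an atom or equals bot.\<close>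

lemma tnorm_on_idem_tnorm: "tnorm_on C_tilde (idem_tnorm E)"
proof -
  have mono: "idem_tnorm E x y \<le> idem_tnorm E x z"
    if "y \<in> C_tilde" "z \<in> C_tilde" "y \<le> z" for x y z :: "'a tilde"
    using C_tilde_cases[OF that] that(3) by (auto simp: idem_tnorm_def top_unique)
  have comm: "idem_tnorm E x y = idem_tnorm E y x" for x y :: "'a tilde"
    by (auto simp: idem_tnorm_def)
  have mono': "idem_tnorm E y x \<le> idem_tnorm E z x"
    if "y \<in> C_tilde" "z \<in> C_tilde" "y \<le> z" for x y z :: "'a tilde"
    using mono[OF that] by (simp only: comm[of _ x])
  have assoc: "idem_tnorm E (idem_tnorm E x y) z = idem_tnorm E x (idem_tnorm E y z)"
    for x y z :: "'a tilde"
  proof (cases "(bot :: 'a tilde) = top")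
    \<comment> \<open>In the one-point lattice the default value \<open>bot\<close> would be read as
      the unit, but there all elements coincide.\<close>
    case True
    then have "u = top" for u :: "'a tilde"
      by (metis bot_least top_unique)
    then show ?thesis by metis
  qed (auto simp: idem_tnorm_def)
  have clos: "idem_tnorm E x y \<in> C_tilde" if "x \<in> C_tilde" "y \<in> C_tilde" for x y
    using that by (auto simp: idem_tnorm_def)
  have unit: "idem_tnorm E x top = x" "idem_tnorm E top x = x" for x
    by (auto simp: idem_tnorm_def)
  show ?thesis
    unfolding tnorm_on_def
    by (intro conjI ballI impI; (rule mono mono' comm assoc clos unit; assumption))
qed

text \<open>Away from top, \<open>T u v\<close> lies below both arguments, so it is bot or equal to
  both. Hence \<open>T\<close> vanishes off the diagonal, and a nonzero square of \<open>u\<close>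
  is \<open>u\<close> itself.\<close>

lemma tnorm_on_C_tilde_eq:
  assumes T: "tnorm_on C_tilde T" and u: "u \<in> C_tilde" and v: "v \<in> C_tilde"
  shows "T u v = idem_tnorm {a. T a a \<noteq> bot} u v"
proof (cases "u = top \<or> v = top")
  case True
  then show ?thesis
    using T u v by (auto simp: tnorm_on_def idem_tnorm_def)
next
  case False
  have C: "T u v \<in> C_tilde"
    using T u v by (auto simp: tnorm_on_def)
  have "T u v \<le> u" "T u v \<le> v"
    using tnorm_on_le[OF T top_in_C_tilde u v] .
  then show ?thesis
    using C_tilde_cases[OF C u] C_tilde_cases[OF C v] False
    by (auto simp: idem_tnorm_def)
qed

section \<open>The extension \<open>tbar\<close>\<close>

lemma kappa_subset: "kappa x \<subseteq> C_tilde"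
  by (auto simp: kappa_def)

lemma tbar_cong:
  assumes "\<And>u v. u \<in> C_tilde \<Longrightarrow> v \<in> C_tilde \<Longrightarrow> T u v = T' u v"
  shows "tbar T = tbar T'"
  unfolding tbar_def using assms kappa_subset by (intro ext SUP_cong) auto

lemma tbar_mono:
  assumes "\<And>u v. u \<in> C_tilde \<Longrightarrow> v \<in> C_tilde \<Longrightarrow> T u v \<le> T' u v"
  shows "tbar T x y \<le> tbar T' x y"
  unfolding tbar_def
  by (intro SUP_mono' SUP_subset_mono order.refl assms) (use kappa_subset in auto)

lemma tbar_sup: "tbar (\<lambda>u v. sup (T u v) (T' u v)) x y = sup (tbar T x y) (tbar T' x y)"
  unfolding tbar_def Complete_Lattices.SUP_sup_distrib ..

lemma w_atom_neq_top: "p \<in> H_set \<Longrightarrow> w_atom p \<noteq> top"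
  by (metis emb_top emb_neq_w_atom(2))

lemma emb_eq_top_iff: "emb x = top \<longleftrightarrow> x = top"
  by (metis emb_top emb_eq_iff)

text \<open>Atomisticity, by induction on the number of elements strictly below \<open>y\<close>: an
  atom is in its own \<open>kappa\<close>, an element of \<open>H_set\<close> contributes its
  \<open>w_atom\<close>, and a join-reducible element is a join of two smaller ones.\<close>

lemma Sup_kappa_emb:
  fixes y :: "'a::{finite, bounded_lattice}"
  shows "Sup (kappa (emb y)) = emb y"
proof (induction "card {x. x < y}" arbitrary: y rule: less_induct)
  case less
  let ?s = "Sup (kappa (emb y))"
  have le: "?s \<le> emb y"
    by (auto intro: Sup_least simp: kappa_def)
  have below: "emb z \<le> ?s" if "z < y" for z
  proof -
    have "{x. x < z} \<subset> {x. x < y}"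
      using that by (auto intro: order.strict_trans)
    then have "emb z = Sup (kappa (emb z))"
      using less by (simp add: psubset_card_mono)
    also have "\<dots> \<le> ?s"
      using that by (intro Sup_subset_mono) (auto simp: kappa_def intro: order.trans)
    finally show ?thesis .
  qed
  consider "y = bot" | "y \<in> atoms" | "y \<in> H_set"
    | "y \<noteq> bot" "y \<notin> join_irreducibles"
    by (auto simp: H_set_def)
  then have "emb y \<le> ?s"
  proof cases
    case 1
    then show ?thesis by (simp add: emb_bot)
  next
    case 2
    then have "emb y \<in> kappa (emb y)"
      by (auto simp: kappa_def C_tilde_def atoms_tilde emb_bot[symmetric]) (simp add: atoms_def)
    then show ?thesis by (rule Sup_upper)
  next
    case 3
    then have "w_atom y \<in> kappa (emb y)"
      by (auto simp: kappa_def C_tilde_def atoms_tilde emb_bot[symmetric])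
    then have w: "w_atom y \<le> ?s" by (rule Sup_upper)
    have "y \<noteq> bot" "y \<notin> atoms"
      using 3 by (auto simp: H_set_def join_irreducibles_def)
    \<comment> \<open>The bound by \<open>w_atom y\<close> alone leaves open that the join is
      \<open>w_atom y\<close>. The element \<open>z\<close> excludes this, because nothing from L
      except bot lies below an added atom.\<close>
    then obtain z where z: "bot < z" "z < y"
      by (auto simp: atoms_def bot.not_eq_extremum)
    show ?thesis
    proof (cases ?s rule: tilde_cases)
      case (emb x)
      then show ?thesis using w 3 by simp
    next
      case (w_atom p)
      then show ?thesis using below[OF z(2)] z(1) by simp
    qed
  next
    case 4
    then obtain a b where ab: "sup a b = y" "a \<noteq> y" "b \<noteq> y"
      by (auto simp: join_irreducibles_def)
    then have "a < y" "b < y"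
      by (auto simp: less_le)
    then show ?thesis
      using below by (simp flip: ab(1) add: emb_sup)
  qed
  with le show ?case by (rule order.antisym)
qed

text \<open>The unit law makes every \<open>v\<close> in \<open>kappa (emb y)\<close> occur among
  the joined values, and \<open>Sup_kappa_emb\<close> joins them to \<open>emb y\<close>; the bound
  of \<open>T\<close> by its arguments gives the converse.\<close>

lemma tbar_top:
  assumes T: "tnorm_on C_tilde T"
  shows "tbar T (emb top) (emb y) = emb y" "tbar T (emb y) (emb top) = emb y"
proof -
  have unit: "T top v = v" "T v top = v" if "v \<in> C_tilde" for v
    using T that by (auto simp: tnorm_on_def)
  have bound: "T u v \<le> u" "T u v \<le> v" if "u \<in> C_tilde" "v \<in> C_tilde" for u v
    using tnorm_on_le[OF T top_in_C_tilde that] .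
  have C: "v \<in> C_tilde" if "v \<in> kappa x" for v x
    using that kappa_subset by blast
  have kappa_le: "v \<le> x" if "v \<in> kappa x" for v x
    using that by (simp add: kappa_def)
  have "tbar T (emb top) (emb y) \<le> emb y" "tbar T (emb y) (emb top) \<le> emb y"
    unfolding tbar_def
    by (intro SUP_least; meson bound C kappa_le order.trans)+
  moreover have "v \<le> tbar T (emb top) (emb y)" "v \<le> tbar T (emb y) (emb top)"
    if v: "v \<in> kappa (emb y)" for v
  proof -
    \<comment> \<open>\<open>kappa\<close> omits bot, so it contains top only if the lattice is
      nontrivial; the existence of \<open>v\<close> guarantees that.\<close>
    have "v \<noteq> bot" using v by (simp add: kappa_def)
    then have "(top :: 'a tilde) \<noteq> bot" by (metis bot_unique top_greatest)
    then have top: "top \<in> kappa (emb (top :: 'a))"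
      by (simp add: kappa_def emb_top)
    show "v \<le> tbar T (emb top) (emb y)"
      unfolding tbar_def using top v unit C[OF v] by (intro SUP_upper2[OF top] SUP_upper2[OF v]) simp
    show "v \<le> tbar T (emb y) (emb top)"
      unfolding tbar_def using top v unit C[OF v] by (intro SUP_upper2[OF v] SUP_upper2[OF top]) simp
  qed
  ultimately show "tbar T (emb top) (emb y) = emb y" "tbar T (emb y) (emb top) = emb y"
    by (metis Sup_kappa_emb Sup_least order.antisym)+
qed

definition idem_join :: "('a::{finite, bounded_lattice} tilde \<Rightarrow> 'a tilde \<Rightarrow> 'a tilde) \<Rightarrow> 'a \<Rightarrow> 'a tilde"
  where "idem_join T z = Sup {a \<in> atoms. T a a \<noteq> bot \<and> a \<le> emb z}"

text \<open>With both arguments different from top, no member of the two \<open>kappa\<close> sets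
  is top. Only the diagonal terms \<open>T a a = a\<close> survive, for atoms \<open>a\<close> below
  both arguments.\<close>

lemma tbar_emb:
  assumes T: "tnorm_on C_tilde T" and "x \<noteq> top" "y \<noteq> top"
  shows "tbar T (emb x) (emb y) = idem_join T (inf x y)"
proof (rule order.antisym)
  let ?A = "{a \<in> atoms. T a a \<noteq> bot \<and> a \<le> emb (inf x y)}"
  have diag: "T a a = a" if "a \<in> C_tilde" "T a a \<noteq> bot" for a
    using that by (subst tnorm_on_C_tilde_eq[OF T]) (simp_all add: idem_tnorm_def)
  have off: "T u v = bot"
    if "u \<in> C_tilde" "v \<in> C_tilde" "u \<noteq> v" "u \<noteq> top" "v \<noteq> top" for u v
    using that by (subst tnorm_on_C_tilde_eq[OF T]) (simp_all add: idem_tnorm_def)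
  have kap: "u \<in> atoms \<and> u \<noteq> top \<and> u \<noteq> bot \<and> u \<in> C_tilde \<and> u \<le> emb z"
    if "u \<in> kappa (emb z)" "z \<noteq> top" for u and z :: 'a
    using that emb_eq_top_iff top_unique by (auto simp: kappa_def C_tilde_def)
  show "tbar T (emb x) (emb y) \<le> idem_join T (inf x y)"
    unfolding tbar_def idem_join_def
  proof (intro SUP_least)
    fix u v assume "u \<in> kappa (emb x)" "v \<in> kappa (emb y)"
    note uv = kap[OF this(1) assms(2)] kap[OF this(2) assms(3)]
    show "T u v \<le> Sup ?A"
    proof (cases "u = v \<and> T u u \<noteq> bot")
      case True
      then have "u \<in> ?A" using uv by (auto simp: emb_inf)
      then have "u \<le> Sup ?A" by (rule Sup_upper)
      moreover have "T u v = u" using True uv diag by auto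
      ultimately show ?thesis by (simp only:)
    next
      case False
      then show ?thesis using uv off[of u v] by (cases "u = v") auto
    qed
  qed
  show "idem_join T (inf x y) \<le> tbar T (emb x) (emb y)"
    unfolding idem_join_def
  proof (rule Sup_least)
    fix a assume "a \<in> ?A"
    then have a: "a \<in> kappa (emb x)" "a \<in> kappa (emb y)" "T a a \<noteq> bot" "a \<in> C_tilde"
      by (auto simp: kappa_def C_tilde_def emb_inf atoms_def)
    then have "T a a = a" using diag by simp
    then show "a \<le> tbar T (emb x) (emb y)"
      unfolding tbar_def using a by (intro SUP_upper2[OF a(1)] SUP_upper2[OF a(2)]) simp
  qed
qed

section \<open>Condition (C) and values in L\<close>

lemma idem_join_in_range_emb:
  assumes C: "cond_C T" and z: "z \<noteq> top"
  shows "idem_join T z \<in> range emb"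
proof (cases "idem_join T z" rule: tilde_cases)
  case (w_atom p)
  let ?A = "{a \<in> atoms. T a a \<noteq> bot \<and> a \<le> emb z}"
  \<comment> \<open>The members of \<open>?A\<close> are atoms below their join, which is assumed to
    be the atom \<open>w_atom p\<close>.\<close>
  have only: "a = w_atom p" if "a \<in> ?A" for a
  proof -
    have "a \<le> w_atom p"
      using Sup_upper[OF that] w_atom(2) by (simp only: idem_join_def)
    then show ?thesis
      using that w_atom(1) by (cases a rule: tilde_cases) (auto simp: atoms_def emb_bot)
  qed
  have "idem_join T z \<noteq> bot"
    using w_atom by (metis emb_bot emb_neq_w_atom(2))
  then have "?A \<noteq> {}"
    unfolding idem_join_def by (rule contrapos_nn) (simp only: Sup_empty)
  then have p: "w_atom p \<in> ?A"
    using only by blast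
  then have pz: "p \<le> z" using w_atom(1) by simp
  \<comment> \<open>Since \<open>z\<close> is not top, neither is \<open>p\<close>, so (C) applies;
    its second atom \<open>u\<close> contradicts \<open>only\<close>.\<close>
  then have "p \<in> H_set - {top}"
    using w_atom(1) z top_unique by auto
  then obtain u where u: "u \<in> atoms" "u \<le> emb p" "u \<noteq> w_atom p" "T u u \<noteq> bot"
    using C p by (auto simp: cond_C_def)
  then have "u \<in> ?A"
    using pz by (auto intro: order.trans)
  then show ?thesis using only u by blast
qed auto

lemma restrict_L_tbar_in_tnorms_L:
  assumes T: "tnorm_on C_tilde T" and C: "cond_C T"
  shows "restrict_L (tbar T) \<in> tnorms_L"
proof -
  \<comment> \<open>At top the join may fall outside L, leaving \<open>g top\<close> arbitrary;
    hence the guard in every fact about \<open>g\<close>.\<close>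
  define g where "g z = inv emb (idem_join T z)" for z
  have g: "emb (g z) = idem_join T z" if "z \<noteq> top" for z
    unfolding g_def using idem_join_in_range_emb[OF C that] by (rule f_inv_into_f)
  have inf_top: "inf x y \<noteq> top" if "x \<noteq> top" for x y :: 'a
    using that by (metis inf.cobounded1 top_unique)
  have le: "g z \<le> z" if "z \<noteq> top" for z
  proof -
    have "emb (g z) \<le> emb z"
      unfolding g[OF that] idem_join_def by (rule Sup_least) simp
    then show ?thesis by simp
  qed
  have mono: "g y \<le> g z" if "z \<noteq> top" "y \<le> z" for y z
  proof -
    have "emb (g y) \<le> emb (g z)"
      using that top_unique by (subst (1 2) g) (auto simp: idem_join_def intro!: Sup_subset_mono
        intro: order.trans)
    then show ?thesis by simp
  qed
  have idem: "g (inf (g z) w) = g (inf z w)" if z: "z \<noteq> top" for z w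
  proof -
    have gz: "g z \<noteq> top" using le[OF z] z by (metis top_unique)
    \<comment> \<open>\<open>g z\<close> is the join of the non-nilpotent atoms below
      \<open>z\<close>, so the same such atoms lie below \<open>z\<close> and \<open>g z\<close>,
      and this persists after meeting with \<open>w\<close>.\<close>
    have "a \<le> emb (g z) \<longleftrightarrow> a \<le> emb z" if "a \<in> atoms" "T a a \<noteq> bot" for a
    proof
      assume "a \<le> emb (g z)"
      then show "a \<le> emb z" using le[OF z] by (meson emb_le_emb order.trans)
    next
      assume "a \<le> emb z"
      then show "a \<le> emb (g z)"
        unfolding g[OF z] idem_join_def using that by (intro Sup_upper) simp
    qed
    then have "{a \<in> atoms. T a a \<noteq> bot \<and> a \<le> emb (inf (g z) w)}
      = {a \<in> atoms. T a a \<noteq> bot \<and> a \<le> emb (inf z w)}"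
      by (auto simp: emb_inf)
    then have "emb (g (inf (g z) w)) = emb (g (inf z w))"
      using g inf_top gz z by (simp add: idem_join_def)
    then show ?thesis by simp
  qed
  let ?t = "\<lambda>x y. if x = top then y else if y = top then x else g (inf x y)"
  have "restrict_L (tbar T) = (\<lambda>x y. emb (?t x y))"
    by (intro ext) (simp add: restrict_L_def tbar_top[OF T] tbar_emb[OF T] g inf_top)
  moreover have "tnorm_on UNIV ?t"
    using le mono idem by (rule tnorm_on_interior)
  ultimately show ?thesis
    unfolding tnorms_L_def mem_Collect_eq by (intro exI[of _ ?t] conjI)
qed

section \<open>Joins and least element of \<open>S_set\<close>\<close>

lemma cond_C_idem_tnorm_iff:
  "cond_C (idem_tnorm E) \<longleftrightarrow> (\<forall>p\<in>H_set - {top}. w_atom p \<in> E \<longrightarrow>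
    (\<exists>u\<in>{a \<in> atoms. a \<le> emb p} - {w_atom p}. u \<in> E))"
proof -
  have "idem_tnorm E (w_atom p) (w_atom p) \<noteq> bot \<longleftrightarrow> w_atom p \<in> E" if "p \<in> H_set" for p
    using that w_atom_neq_top[OF that]
    by (auto simp: idem_tnorm_def) (metis emb_bot emb_neq_w_atom(2))
  \<comment> \<open>For \<open>p\<close> different from top, \<open>u\<close> cannot be top, whose
    square is top whatever \<open>E\<close> is.\<close>
  moreover have "idem_tnorm E u u \<noteq> bot \<longleftrightarrow> u \<in> E"
    if "u \<in> atoms" "u \<le> emb p" "p \<noteq> top" for u p
    using that emb_eq_top_iff top_unique by (auto simp: idem_tnorm_def atoms_def)
  ultimately show ?thesis
    unfolding cond_C_def by blast
qed

text \<open>The union \<open>E\<close> represents the pointwise join of the two t-norms on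
  \<open>C_tilde\<close>, and \<open>tbar\<close>, being built from joins, commutes with it.\<close>

lemma S_set_sup_closed:
  assumes "f \<in> S_set" "g \<in> S_set"
  shows "sup f g \<in> S_set"
proof -
  obtain T1 T2 where T1: "f = restrict_L (tbar T1)" "tnorm_on C_tilde T1" "cond_C T1"
    and T2: "g = restrict_L (tbar T2)" "tnorm_on C_tilde T2" "cond_C T2"
    using assms by (auto simp: S_set_def)
  define E where "E = {a. T1 a a \<noteq> bot} \<union> {a. T2 a a \<noteq> bot}"
  have "idem_tnorm E u v = sup (T1 u v) (T2 u v)" if "u \<in> C_tilde" "v \<in> C_tilde" for u v
    unfolding tnorm_on_C_tilde_eq[OF T1(2) that] tnorm_on_C_tilde_eq[OF T2(2) that]
    by (auto simp: idem_tnorm_def E_def)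
  then have "tbar (idem_tnorm E) = tbar (\<lambda>u v. sup (T1 u v) (T2 u v))"
    by (rule tbar_cong)
  then have "restrict_L (tbar (idem_tnorm E)) = sup f g"
    by (intro ext) (simp add: restrict_L_def tbar_sup T1(1) T2(1))
  \<comment> \<open>A witness \<open>u\<close> for \<open>T1\<close> or for \<open>T2\<close>
    remains one for the union.\<close>
  moreover have "cond_C (idem_tnorm E)"
    using T1(3) T2(3) unfolding cond_C_idem_tnorm_iff by (fastforce simp: cond_C_def E_def)
  ultimately show ?thesis
    using tnorm_on_idem_tnorm[of E] unfolding S_set_def mem_Collect_eq by metis
qed

text \<open>\<open>idem_tnorm {}\<close> is the drastic t-norm, the least one on
  \<open>C_tilde\<close>; it satisfies (C) vacuously.\<close>

lemma restrict_L_tbar_least: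
  "restrict_L (tbar (idem_tnorm {})) \<in> S_set"
  "f \<in> S_set \<Longrightarrow> restrict_L (tbar (idem_tnorm {})) \<le> f"
proof -
  have "cond_C (idem_tnorm {})"
    by (simp add: cond_C_idem_tnorm_iff)
  then show "restrict_L (tbar (idem_tnorm {})) \<in> S_set"
    using tnorm_on_idem_tnorm unfolding S_set_def by blast
next
  assume "f \<in> S_set"
  then obtain T where f: "f = restrict_L (tbar T)" and T: "tnorm_on C_tilde T"
    by (auto simp: S_set_def)
  have "idem_tnorm {} u v \<le> T u v" if "u \<in> C_tilde" "v \<in> C_tilde" for u v
    unfolding tnorm_on_C_tilde_eq[OF T that] by (auto simp: idem_tnorm_def)
  then show "restrict_L (tbar (idem_tnorm {})) \<le> f"
    by (auto simp: f le_fun_def restrict_L_def intro: tbar_mono)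
qed

theorem theorem6p9:
  shows "(S_set :: ('a::{finite, bounded_lattice} \<Rightarrow> 'a \<Rightarrow> 'a tilde) set) \<subseteq> tnorms_L
    \<and> S_set \<noteq> ({} :: ('a \<Rightarrow> 'a \<Rightarrow> 'a tilde) set)
    \<and> lattice (pointwise_order (S_set :: ('a \<Rightarrow> 'a \<Rightarrow> 'a tilde) set))"
proof (intro conjI)
  show "(S_set :: ('a \<Rightarrow> 'a \<Rightarrow> 'a tilde) set) \<subseteq> tnorms_L"
    using restrict_L_tbar_in_tnorms_L by (auto simp: S_set_def)
  \<comment> \<open>The locale \<open>lattice\<close> admits an empty carrier, so nonemptiness is a
    separate claim.\<close>
  show "(S_set :: ('a \<Rightarrow> 'a \<Rightarrow> 'a tilde) set) \<noteq> {}"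
    using restrict_L_tbar_least(1) by blast
  show "lattice (pointwise_order (S_set :: ('a \<Rightarrow> 'a \<Rightarrow> 'a tilde) set))"
    \<comment> \<open>Finiteness of \<open>S_set\<close> comes from its type, functions between
      finite types.\<close>
    using S_set_sup_closed restrict_L_tbar_least by (intro lattice_pointwise_order) simp_all
qed

end
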